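(* Let $m\ge 1$ and let $\mathbf{q}=[q_1,\dots,q_m]'$ be a probability mass function with $m$-element support (the prior generator), i.e. $q_i>0$ for all $i$ and $\sum_{i=1}^m q_i=1$. For each integer $n\ge 1$ let $\mathcal{H}_n$ be the set of all occurrence vectors $\mathbf{n}=[n_1,\dots,n_m]'$ of non-negative integers with $\sum_{i=1}^m n_i=n$, and let $$\tilde{\mathbf{n}}^{(n)}\in\arg\max_{\mathbf{n}\in\mathcal{H}_n}\ \pi(\mathbf{n}\mid\mathbf{q})\,\pi\!\left(n\mathbf{q}\,\Big|\,\frac{\mathbf{n}}{n}\right).$$ Let $\mathcal{P}$ be the set of all probability vectors $\mathbf{p}=[p_1,\dots,p_m]'$ ($p_i\ge 0$, $\sum_{i=1}^m p_i=1$), and let $$\tilde{\mathbf{p}}=\arg\max_{\mathbf{p}\in\mathcal{P}}J(\mathbf{p},\mathbf{q}),\qquad J(\mathbf{p},\mathbf{q})=-\sum_{i=1}^m\left\{p_i\ln\left(\frac{p_i}{q_i}\right)+q_i\ln\left(\frac{q_i}{p_i}\right)\right\}.$$ Then $$\lim_{n\to\infty}\frac{\tilde{\mathbf{n}}^{(n)}}{n}=\tilde{\mathbf{p}}.$$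
   Context: For a vector $\mathbf{a}=[a_1,\dots,a_m]'$ with non-negative real entries and $\sum_{i=1}^m a_i=n$, and a probability vector $\mathbf{r}=[r_1,\dots,r_m]'$, define $$\pi(\mathbf{a}\mid\mathbf{r})=\frac{\Gamma(n+1)}{\prod_{i=1}^m\Gamma(a_i+1)}\prod_{i=1}^m r_i^{a_i},$$ where $\Gamma$ is the gamma function, $0^0=1$, and $0^a=0$ for $a>0$. When $\mathbf{a}$ has integer entries this is the multinomial probability of obtaining the vector of absolute frequencies $\mathbf{a}$ in $n$ independent draws from $\mathbf{r}$. Conventions for $J$: $0\ln 0=0$, and $q_i\ln(q_i/0)=+\infty$, so $J(\mathbf{p},\mathbf{q})=-\infty$ if some $p_i=0$. $J(\mathbf{p},\mathbf{q})$ is called Jeffreys' relative entropy of $\mathbf{p}$ on the generator $\mathbf{q}$, i.e. minus the $J$-divergence. *)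

theory Defs
  imports "HOL-Analysis.Analysis"
begin

text \<open>A separate power function is needed because \<open>0 powr 0 = 0\<close> in the library,
  whereas here \<open>0\<^sup>0 = 1\<close> (and \<open>0\<^sup>a = 0\<close> for \<open>a > 0\<close>).\<close>

definition rpow :: "real \<Rightarrow> real \<Rightarrow> real" where
  "rpow x a = (if a = 0 then 1 else x powr a)"

definition multinomial_weight :: "real ^ 'm \<Rightarrow> real ^ 'm \<Rightarrow> real" where
  "multinomial_weight a r =
     Gamma ((\<Sum>i\<in>UNIV. a $ i) + 1) / (\<Prod>i\<in>UNIV. Gamma (a $ i + 1))
       * (\<Prod>i\<in>UNIV. rpow (r $ i) (a $ i))"

definition prob_vectors :: "(real ^ 'm) set" where
  "prob_vectors = {p. (\<forall>i. 0 \<le> p $ i) \<and> (\<Sum>i\<in>UNIV. p $ i) = 1}"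

definition occurrence_vectors :: "nat \<Rightarrow> (nat ^ 'm) set" where
  "occurrence_vectors n = {k. (\<Sum>i\<in>UNIV. k $ i) = n}"

definition real_vec :: "nat ^ 'm \<Rightarrow> real ^ 'm" where
  "real_vec k = (\<chi> i. real (k $ i))"

definition joint_weight :: "real ^ 'm \<Rightarrow> nat \<Rightarrow> nat ^ 'm \<Rightarrow> real" where
  "joint_weight q n k =
     multinomial_weight (real_vec k) q
       * multinomial_weight (real n *\<^sub>R q) (real_vec k /\<^sub>R real n)"

text \<open>The value of \<open>a ln (a / b)\<close> for \<open>a, b \<ge> 0\<close>, with \<open>0 ln 0 = 0\<close> and
  \<open>a ln (a / 0) = \<infinity>\<close> for \<open>a > 0\<close>. It never equals \<open>-\<infinity>\<close>, so sums of such terms involve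
  no \<open>\<infinity> - \<infinity>\<close>.\<close>

definition log_ratio_term :: "real \<Rightarrow> real \<Rightarrow> ereal" where
  "log_ratio_term a b =
     (if a = 0 then 0 else if b = 0 then \<infinity> else ereal (a * ln (a / b)))"

definition jeffreys_entropy :: "real ^ 'm \<Rightarrow> real ^ 'm \<Rightarrow> ereal" where
  "jeffreys_entropy p q =
     - (\<Sum>i\<in>UNIV. log_ratio_term (p $ i) (q $ i) + log_ratio_term (q $ i) (p $ i))"

end

theory Submission
  imports Defs
begin

text \<open>Each summand of the \<open>J\<close>-divergence is \<open>(p\<^sub>i - q\<^sub>i) ln (p\<^sub>i / q\<^sub>i) \<ge> 0\<close>, so the maximiser of
  \<open>J(\<cdot>, q)\<close> is \<open>q\<close> itself. The joint weight of \<open>k\<close> is, up to a factor independent of \<open>k\<close>, a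
  product of one-coordinate factors. Moving a single unit from coordinate \<open>i\<close> to coordinate
  \<open>j\<close> cannot increase it at a maximiser, which yields
  \<open>q\<^sub>j / (k\<^sub>j + 1) exp (n q\<^sub>j / (k\<^sub>j + 1)) \<le> q\<^sub>i / k\<^sub>i exp (n q\<^sub>i / (k\<^sub>i - 1))\<close>. For large \<open>n\<close> this
  is violated as soon as \<open>k\<^sub>i / n \<ge> (1 + \<epsilon>) q\<^sub>i\<close> and \<open>k\<^sub>j / n \<le> q\<^sub>j\<close>; a \<open>j\<close> of the latter kind always
  exists, so \<open>k\<^sub>i / n < (1 + \<epsilon>) q\<^sub>i\<close> for all \<open>i\<close>, and lower bounds follow by summation.\<close>

section \<open>The maximiser of Jeffreys' entropy\<close>

lemma log_ratio_term_sym: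
  fixes a b :: real
  assumes "a > 0" "b > 0"
  shows "log_ratio_term a b + log_ratio_term b a = ereal ((a - b) * (ln a - ln b))"
  using assms by (simp add: log_ratio_term_def ln_div algebra_simps)

lemma log_ratio_term_sym_nonneg:
  fixes a b :: real
  assumes "a \<ge> 0" "b > 0"
  shows "0 \<le> log_ratio_term a b + log_ratio_term b a"
proof (cases "a = 0")
  case True
  then show ?thesis using assms by (simp add: log_ratio_term_def)
next
  case False
  then have "a > 0" using assms by simp
  moreover have "0 \<le> (a - b) * (ln a - ln b)"
    using \<open>a > 0\<close> \<open>b > 0\<close> by (cases "a \<le> b") (auto intro: mult_nonneg_nonneg mult_nonpos_nonpos)
  ultimately show ?thesis using assms by (simp add: log_ratio_term_sym)
qed

text \<open>For \<open>a = 0\<close> the second term is infinite, so the hypothesis fails; for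
  \<open>a > 0\<close> injectivity of \<open>ln\<close> on the positive reals decides.\<close>

lemma log_ratio_term_sym_eq_0D:
  fixes a b :: real
  assumes "a \<ge> 0" "b > 0" "log_ratio_term a b + log_ratio_term b a = 0"
  shows "a = b"
proof (cases "a = 0")
  case True
  then show ?thesis using assms by (simp add: log_ratio_term_def)
next
  case False
  then have "a > 0" using assms by simp
  then have "(a - b) * (ln a - ln b) = 0"
    using assms by (simp add: log_ratio_term_sym del: mult_eq_0_iff)
  then show ?thesis using \<open>a > 0\<close> \<open>b > 0\<close> by auto
qed

lemma jeffreys_entropy_arg_max:
  fixes p q :: "real ^ 'm"
  assumes q: "\<And>i. q $ i > 0" "(\<Sum>i\<in>UNIV. q $ i) = 1"
    and p: "is_arg_max (\<lambda>p'. jeffreys_entropy p' q) (\<lambda>p'. p' \<in> prob_vectors) p"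
  shows "p = q"
proof -
  let ?t = "\<lambda>i. log_ratio_term (p $ i) (q $ i) + log_ratio_term (q $ i) (p $ i)"
  have p_nonneg: "p $ i \<ge> 0" for i
    using p by (auto simp: is_arg_max_def prob_vectors_def)
  have "q \<in> prob_vectors" using q by (auto simp: prob_vectors_def intro: less_imp_le)
  then have "jeffreys_entropy q q \<le> jeffreys_entropy p q"
    using p by (auto simp: is_arg_max_def not_less)
  moreover have "jeffreys_entropy q q = 0"
    using q(1) by (simp add: jeffreys_entropy_def log_ratio_term_sym)
  ultimately have "sum ?t UNIV \<le> 0"
    by (simp add: jeffreys_entropy_def ereal_0_le_uminus_iff)
  moreover have nonneg: "0 \<le> ?t i" for i
    using log_ratio_term_sym_nonneg[OF p_nonneg q(1)] .
  ultimately have "sum ?t UNIV = 0" by (meson antisym sum_nonneg)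
  then have "?t i = 0" for i
    using nonneg sum_nonneg_eq_0_iff[of UNIV ?t] by auto
  then show ?thesis
    using log_ratio_term_sym_eq_0D[OF p_nonneg q(1)] by (simp add: vec_eq_iff)
qed

section \<open>One-coordinate factors of the joint weight\<close>

text \<open>With \<open>c\<close> = \<open>q $ i\<close> and \<open>t\<close> =
  \<open>k $ i\<close>, this collects what depends on coordinate \<open>i\<close>:
  \<open>c ^ t / fact t\<close> from the multinomial probability of \<open>k\<close> under
  \<open>q\<close>, the power from that of \<open>n q\<close> under \<open>k / n\<close>.\<close>

definition coord_weight :: "real \<Rightarrow> nat \<Rightarrow> nat \<Rightarrow> real" where
  "coord_weight c n t = c ^ t / fact t * rpow (real t / real n) (real n * c)"

lemma coord_weight_nonneg: "c > 0 \<Longrightarrow> 0 \<le> coord_weight c n t"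
  by (simp add: coord_weight_def rpow_def)

lemma coord_weight_pos: "c > 0 \<Longrightarrow> n > 0 \<Longrightarrow> t > 0 \<Longrightarrow> 0 < coord_weight c n t"
  by (simp add: coord_weight_def rpow_def)

lemma coord_weight_0: "c > 0 \<Longrightarrow> n > 0 \<Longrightarrow> coord_weight c n 0 = 0"
  by (simp add: coord_weight_def rpow_def)

lemma coord_weight_Suc:
  assumes "c > 0" "n > 0" "t > 0"
  shows "coord_weight c n (Suc t) =
    coord_weight c n t * (c / real (Suc t) * exp (real n * c * ln (1 + 1 / real t)))"
proof -
  have "1 + 1 / real t = real (Suc t) / real t" using assms by (simp add: field_simps)
  then have "real (Suc t) / real n = real t / real n * (1 + 1 / real t)"
    using assms by simp
  then have "(real (Suc t) / real n) powr (real n * c) =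
      (real t / real n) powr (real n * c) * exp (real n * c * ln (1 + 1 / real t))"
    using assms by (simp only: powr_mult) (simp add: powr_def add_pos_pos add_nonneg_eq_0_iff)
  then show ?thesis
    using assms by (simp add: coord_weight_def rpow_def mult_ac)
qed

text \<open>Since \<open>ln x\<close> \<le> \<open>x - 1\<close> at \<open>x = t / (t + 1)\<close>,
  \<open>ln (1 + 1 / t)\<close> is at least \<open>1 / (t + 1)\<close>.\<close>

lemma coord_weight_Suc_ge:
  assumes "c > 0" "n > 0" "t > 0"
  shows "coord_weight c n t * (c / real (Suc t) * exp (real n * c / real (Suc t)))
    \<le> coord_weight c n (Suc t)"
proof -
  have "ln (real t / real (Suc t)) \<le> real t / real (Suc t) - 1"
    using assms by (intro ln_le_minus_one) simp
  moreover have "1 + 1 / real t = real (Suc t) / real t" using assms by (simp add: field_simps)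
  moreover have "1 / real (Suc t) = 1 - real t / real (Suc t)" by (simp add: field_simps)
  ultimately have "1 / real (Suc t) \<le> ln (1 + 1 / real t)"
    using assms by (simp add: ln_div)
  then have "real n * c * (1 / real (Suc t)) \<le> real n * c * ln (1 + 1 / real t)"
    using assms by (intro mult_left_mono) auto
  then show ?thesis
    unfolding coord_weight_Suc[OF assms]
    using assms by (intro mult_left_mono coord_weight_nonneg) auto
qed

lemma coord_weight_Suc_le:
  assumes "c > 0" "n > 0" "t > 0"
  shows "coord_weight c n (Suc t)
    \<le> coord_weight c n t * (c / real (Suc t) * exp (real n * c / real t))"
proof -
  have "ln (1 + 1 / real t) \<le> 1 / real t"
    by (intro ln_add_one_self_le_self) simp
  then have "real n * c * ln (1 + 1 / real t) \<le> real n * c * (1 / real t)"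
    using assms by (intro mult_left_mono) auto
  then show ?thesis
    unfolding coord_weight_Suc[OF assms]
    using assms by (intro mult_left_mono coord_weight_nonneg) auto
qed

lemma joint_weight_eq_prod_coord_weight:
  fixes q :: "real ^ 'm"
  assumes "\<And>i. q $ i > 0" "(\<Sum>i\<in>UNIV. q $ i) = 1"
  obtains C where "C > 0"
    "\<And>k. k \<in> occurrence_vectors n \<Longrightarrow>
      joint_weight q n k = C * (\<Prod>i\<in>UNIV. coord_weight (q $ i) n (k $ i))"
proof
  \<comment> \<open>\<open>fact n\<close> is the \<open>Gamma\<close> numerator of the first weight;
    the rest is the \<open>Gamma\<close> quotient of the second, whose argument \<open>n q\<close>
    also sums to \<open>n\<close>.\<close>
  let ?C = "fact n * (Gamma (real n + 1) / (\<Prod>i\<in>UNIV. Gamma (real n * q $ i + 1)))"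
  have arg_pos: "real n * q $ i + 1 > 0" for i
    using assms(1)[of i] by (simp add: add_nonneg_pos)
  show "?C > 0"
    by (intro mult_pos_pos divide_pos_pos prod_pos Gamma_real_pos) (auto simp: arg_pos)
  fix k :: "nat ^ 'm" assume k: "k \<in> occurrence_vectors n"
  have rpow_nat: "rpow (q $ i) (real t) = (q $ i) ^ t" for i t
    using assms(1)[of i] by (simp add: rpow_def powr_realpow)
  have "(\<Sum>i\<in>UNIV. real (k $ i)) = real n"
    using k by (simp add: occurrence_vectors_def flip: of_nat_sum)
  moreover have "(\<Sum>i\<in>UNIV. real n * q $ i) = real n"
    using assms(2) by (simp flip: sum_distrib_left)
  moreover have "Gamma (real t + 1) = fact t" for t
    using Gamma_fact[of t, where 'a = real] by (simp add: add.commute)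
  ultimately show "joint_weight q n k = ?C * (\<Prod>i\<in>UNIV. coord_weight (q $ i) n (k $ i))"
    by (simp add: joint_weight_def multinomial_weight_def real_vec_def coord_weight_def rpow_nat
        prod.distrib prod_dividef prod_inversef[unfolded comp_def] divide_inverse_commute)
qed

section \<open>Maximisers of the joint weight\<close>

lemma arg_max_coord_weight_prod_le:
  fixes q :: "real ^ 'm"
  assumes q: "\<And>i. q $ i > 0" "(\<Sum>i\<in>UNIV. q $ i) = 1"
    and N: "is_arg_max (joint_weight q n) (\<lambda>k. k \<in> occurrence_vectors n) N"
    and k: "k \<in> occurrence_vectors n"
  shows "(\<Prod>i\<in>UNIV. coord_weight (q $ i) n (k $ i)) \<le> (\<Prod>i\<in>UNIV. coord_weight (q $ i) n (N $ i))"
proof -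
  obtain C where "C > 0" and C: "\<And>k. k \<in> occurrence_vectors n \<Longrightarrow>
      joint_weight q n k = C * (\<Prod>i\<in>UNIV. coord_weight (q $ i) n (k $ i))"
    using joint_weight_eq_prod_coord_weight[OF q] by blast
  have "N \<in> occurrence_vectors n" "joint_weight q n k \<le> joint_weight q n N"
    using N k by (auto simp: is_arg_max_def not_less)
  then show ?thesis using \<open>C > 0\<close> k by (simp add: C)
qed

text \<open>A zero coordinate makes the whole product vanish, while some occurrence vector has a
  positive product once \<open>n\<close> is at least the dimension.\<close>

lemma arg_max_coord_pos:
  fixes q :: "real ^ 'm"
  assumes q: "\<And>i. q $ i > 0" "(\<Sum>i\<in>UNIV. q $ i) = 1"
    and N: "is_arg_max (joint_weight q n) (\<lambda>k. k \<in> occurrence_vectors n) N"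
    and n: "n \<ge> CARD('m)"
  shows "N $ i > 0"
proof (rule ccontr)
  assume "\<not> N $ i > 0"
  have "n > 0" using n by (metis zero_less_card_finite less_le_trans)
  \<comment> \<open>One unit everywhere, with the surplus placed on coordinate
    \<open>i\<close>.\<close>
  define k :: "nat ^ 'm" where "k = (\<chi> j. 1 + (if j = i then n - CARD('m) else 0))"
  have "(\<Sum>j\<in>UNIV. k $ j) = n"
    unfolding k_def vec_lambda_beta sum.distrib using n by simp
  then have "k \<in> occurrence_vectors n" by (simp add: occurrence_vectors_def)
  note arg_max_coord_weight_prod_le[OF q N this]
  moreover have "(\<Prod>j\<in>UNIV. coord_weight (q $ j) n (k $ j)) > 0"
    by (intro prod_pos ballI coord_weight_pos q \<open>n > 0\<close>) (simp add: k_def)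
  moreover have "(\<Prod>j\<in>UNIV. coord_weight (q $ j) n (N $ j)) = 0"
    using \<open>\<not> N $ i > 0\<close> coord_weight_0[OF q(1) \<open>n > 0\<close>]
    by (intro prod_zero bexI[of _ i]) auto
  ultimately show False by simp
qed

text \<open>The gain at \<open>j\<close> is bounded from below and the loss at \<open>i\<close> from
  above, which is why the exponents have the different denominators \<open>Suc (N $ j)\<close> and
  \<open>t\<close>. Requiring \<open>t > 0\<close> keeps the factor at \<open>i\<close> positive
  after the move.\<close>

lemma arg_max_unit_transfer:
  fixes q :: "real ^ 'm"
  assumes q: "\<And>i. q $ i > 0" "(\<Sum>i\<in>UNIV. q $ i) = 1"
    and N: "is_arg_max (joint_weight q n) (\<lambda>k. k \<in> occurrence_vectors n) N"
    and n: "n \<ge> CARD('m)"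
    and "i \<noteq> j" and Ni: "N $ i = Suc t" "t > 0"
  shows "q $ j / real (Suc (N $ j)) * exp (real n * q $ j / real (Suc (N $ j)))
    \<le> q $ i / real (Suc t) * exp (real n * q $ i / real t)"
    (is "?B \<le> ?A")
proof -
  let ?g = "\<lambda>l. coord_weight (q $ l) n"
  let ?R = "UNIV - {i} - {j}"
  have "n > 0" using n by (metis zero_less_card_finite less_le_trans)
  note pos = arg_max_coord_pos[OF q N n]
  define k where "k = (\<chi> l. if l = i then t else if l = j then Suc (N $ j) else N $ l)"
  have split_sum: "(\<Sum>l\<in>UNIV. f l) = f i + (f j + sum f ?R)" for f :: "'m \<Rightarrow> nat"
    using \<open>i \<noteq> j\<close> by (simp add: sum.remove[of UNIV i] sum.remove[of "UNIV - {i}" j])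
  have split_prod: "(\<Prod>l\<in>UNIV. f l) = f i * (f j * prod f ?R)" for f :: "'m \<Rightarrow> real"
    using \<open>i \<noteq> j\<close> by (simp add: prod.remove[of UNIV i] prod.remove[of "UNIV - {i}" j])
  have k_rest: "k $ l = N $ l" if "l \<in> ?R" for l using that by (simp add: k_def)
  have k_i: "k $ i = t" and k_j: "k $ j = Suc (N $ j)"
    using \<open>i \<noteq> j\<close> by (auto simp: k_def)
  have "(\<Sum>l\<in>UNIV. k $ l) = (\<Sum>l\<in>UNIV. N $ l)"
    unfolding split_sum using k_rest by (simp add: k_i k_j Ni)
  then have "k \<in> occurrence_vectors n"
    using N by (simp add: is_arg_max_def occurrence_vectors_def)
  note le = arg_max_coord_weight_prod_le[OF q N this]
  \<comment> \<open>The factors of the untouched coordinates agree on both sides and are positive,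
    so they cancel.\<close>
  define R where "R = (\<Prod>l\<in>?R. ?g l (N $ l))"
  have "R > 0"
    unfolding R_def by (intro prod_pos ballI coord_weight_pos q pos \<open>n > 0\<close>)
  have "(\<Prod>l\<in>?R. ?g l (k $ l)) = R"
    unfolding R_def using k_rest by (intro prod.cong) auto
  with le have "(?g i t * ?g j (Suc (N $ j))) * R \<le> (?g i (Suc t) * ?g j (N $ j)) * R"
    unfolding split_prod by (simp add: k_i k_j Ni R_def mult_ac)
  then have swap: "?g i t * ?g j (Suc (N $ j)) \<le> ?g i (Suc t) * ?g j (N $ j)"
    using \<open>R > 0\<close> by simp
  define D where "D = ?g i t * ?g j (N $ j)"
  have "D > 0"
    unfolding D_def by (intro mult_pos_pos coord_weight_pos q pos \<open>n > 0\<close> \<open>t > 0\<close>)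
  have "D * ?B = ?g i t * (?g j (N $ j) * ?B)" by (simp add: D_def)
  also have "\<dots> \<le> ?g i t * ?g j (Suc (N $ j))"
    by (intro mult_left_mono coord_weight_Suc_ge coord_weight_nonneg q pos \<open>n > 0\<close>)
  also note swap
  also have "?g i (Suc t) * ?g j (N $ j) \<le> (?g i t * ?A) * ?g j (N $ j)"
    by (intro mult_right_mono coord_weight_Suc_le coord_weight_nonneg q \<open>t > 0\<close> \<open>n > 0\<close>)
  also have "\<dots> = D * ?A" by (simp add: D_def)
  finally show ?thesis using \<open>D > 0\<close> by (simp only: mult_le_cancel_left_pos)
qed

text \<open>The bound on \<open>d\<close> says that one unit is at most \<open>d n q $ i\<close>.
  This absorbs the off-by-one shifts: of the slack \<open>2 * d\<close>, one \<open>d\<close> pays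
  for passing from \<open>N $ i\<close> to \<open>t\<close>, and at \<open>j\<close> one
  \<open>d\<close> pays for the added unit.\<close>

lemma arg_max_coord_upper_bound:
  fixes q :: "real ^ 'm"
  assumes q: "\<And>i. q $ i > 0" "(\<Sum>i\<in>UNIV. q $ i) = 1"
    and N: "is_arg_max (joint_weight q n) (\<lambda>k. k \<in> occurrence_vectors n) N"
    and n: "n \<ge> CARD('m)"
    and d: "d > 0" "\<And>i. 1 \<le> d * (real n * q $ i)"
  shows "real (N $ i) < (1 + 2 * d) * (real n * q $ i)"
proof (rule ccontr)
  assume "\<not> ?thesis"
  then have big: "(1 + 2 * d) * (real n * q $ i) \<le> real (N $ i)" by simp
  have "n > 0" using n by (metis zero_less_card_finite less_le_trans)
  have nq_pos: "real n * q $ l > 0" for l using q(1) \<open>n > 0\<close> by simp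
  have sum_N: "(\<Sum>l\<in>UNIV. real (N $ l)) = real n"
    using N by (simp add: is_arg_max_def occurrence_vectors_def flip: of_nat_sum)
  have sum_nq: "(\<Sum>l\<in>UNIV. real n * q $ l) = real n"
    using q(2) by (simp flip: sum_distrib_left)
  have big': "real (N $ i) \<ge> real n * q $ i + 2"
    using big d(2)[of i] by (simp add: algebra_simps)
  \<comment> \<open>Both vectors sum to \<open>n\<close>, so \<open>N\<close> cannot exceed
    \<open>n q\<close> in every coordinate.\<close>
  obtain j where j: "real (N $ j) \<le> real n * q $ j"
  proof (rule ccontr)
    assume "\<not> thesis"
    with that have "real n * q $ l < real (N $ l)" for l by (meson not_le)
    then have "(\<Sum>l\<in>UNIV. real n * q $ l) < (\<Sum>l\<in>UNIV. real (N $ l))"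
      by (intro sum_strict_mono) auto
    then show False using sum_N sum_nq by simp
  qed
  have "i \<noteq> j" using j big' by auto
  obtain t where t: "N $ i = Suc t" "t > 0"
    using big' nq_pos[of i] by (cases "N $ i") auto
  \<comment> \<open>The threshold separating the two ratios: the one at \<open>j\<close> is at least
    \<open>?u\<close>, those at \<open>i\<close> are at most \<open>?u\<close>. Both sides are
    compared with \<open>?u * exp ?u\<close>.\<close>
  let ?u = "1 / (1 + d)"
  have "?u \<le> real n * q $ j / real (Suc (N $ j))"
  proof -
    have "real (Suc (N $ j)) \<le> (1 + d) * (real n * q $ j)"
      using j d(2)[of j] by (simp add: algebra_simps)
    then show ?thesis using d(1) by (simp add: field_simps)
  qed
  then have lower: "?u * exp ?u \<le>
      real n * q $ j / real (Suc (N $ j)) * exp (real n * q $ j / real (Suc (N $ j)))"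
    using d(1) q(1)[of j] by (intro mult_mono) (auto intro!: divide_nonneg_nonneg simp: less_imp_le)
  have t_ge: "(1 + d) * (real n * q $ i) \<le> real t"
    using big d(2)[of i] t by (simp add: algebra_simps)
  \<comment> \<open>The contradiction needs one strict inequality; it comes from
    \<open>t < Suc t\<close>.\<close>
  have "(1 + d) * (real n * q $ i) < real (Suc t)" using t_ge by simp
  then have "real n * q $ i / real (Suc t) < ?u"
    using d(1) by (simp add: field_simps)
  moreover have "real n * q $ i / real t \<le> ?u"
    using t_ge d(1) t(2) by (simp add: field_simps)
  ultimately have "real n * q $ i / real (Suc t) * exp (real n * q $ i / real t) < ?u * exp ?u"
    using nq_pos[of i] d(1) by (intro mult_less_le_imp_less) auto
  also note lower
  also have "real n * q $ j / real (Suc (N $ j)) * exp (real n * q $ j / real (Suc (N $ j)))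
      \<le> real n * q $ i / real (Suc t) * exp (real n * q $ i / real t)"
    using mult_left_mono[OF arg_max_unit_transfer[OF q N n \<open>i \<noteq> j\<close> t], of "real n"]
    by (simp add: mult.assoc)
  finally show False by simp
qed

section \<open>From upper bounds to convergence\<close>

text \<open>Summing the upper bounds over the other coordinates gives \<open>1 - x $ i\<close> \<le>
  \<open>(1 + e) * (1 - q $ i)\<close>, hence a lower bound on \<open>x $ i\<close>. Both errors are
  at most \<open>e\<close> because \<open>q $ i\<close> lies in the unit interval.\<close>

lemma prob_vector_close:
  fixes q x :: "real ^ 'm"
  assumes q: "\<And>i. q $ i > 0" "(\<Sum>i\<in>UNIV. q $ i) = 1"
    and x: "(\<Sum>i\<in>UNIV. x $ i) = 1" "\<And>i. x $ i \<le> (1 + e) * q $ i" and "e > 0"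
  shows "\<bar>x $ i - q $ i\<bar> \<le> e"
proof -
  have *: "(\<Sum>l\<in>UNIV. f $ l) = f $ i + (\<Sum>l\<in>UNIV - {i}. f $ l)" for f :: "real ^ 'm"
    by (simp add: sum.remove)
  have "(\<Sum>l\<in>UNIV - {i}. x $ l) \<le> (\<Sum>l\<in>UNIV - {i}. (1 + e) * q $ l)"
    using x(2) by (intro sum_mono)
  moreover have "(\<Sum>l\<in>UNIV - {i}. x $ l) = 1 - x $ i" "(\<Sum>l\<in>UNIV - {i}. q $ l) = 1 - q $ i"
    using q(2) x(1) *[of x] *[of q] by simp_all
  ultimately have "1 - x $ i \<le> (1 + e) * (1 - q $ i)"
    by (simp flip: sum_distrib_left)
  moreover have "(\<Sum>l\<in>UNIV - {i}. q $ l) \<ge> 0"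
    using q(1) by (intro sum_nonneg) (auto intro: less_imp_le)
  then have "e * q $ i \<le> e * 1"
    using q(2) *[of q] \<open>e > 0\<close> by (intro mult_left_mono) auto
  moreover have "e * q $ i \<ge> 0" using q(1)[of i] \<open>e > 0\<close> by simp
  moreover note x(2)[of i]
  ultimately show ?thesis by (simp add: algebra_simps abs_le_iff)
qed

theorem theorem3:
  fixes q p :: "real ^ 'm" and N :: "nat \<Rightarrow> nat ^ 'm"
  assumes "\<And>i. q $ i > 0"
    and "(\<Sum>i\<in>UNIV. q $ i) = 1"
    and "\<And>n. n \<ge> 1 \<Longrightarrow> is_arg_max (joint_weight q n) (\<lambda>k. k \<in> occurrence_vectors n) (N n)"
    and "is_arg_max (\<lambda>p'. jeffreys_entropy p' q) (\<lambda>p'. p' \<in> prob_vectors) p"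
  shows "(\<lambda>n. real_vec (N n) /\<^sub>R real n) \<longlonglongrightarrow> p"
proof -
  note q = assms(1,2)
  have "(\<lambda>n. (real_vec (N n) /\<^sub>R real n) $ i) \<longlonglongrightarrow> q $ i" for i
  proof (rule LIMSEQ_I)
    fix r :: real assume "r > 0"
    \<comment> \<open>The final error is at most \<open>2 * d\<close>, that is \<open>r / 2\<close>,
      strictly below \<open>r\<close>.\<close>
    define d where "d = r / 4"
    have "d > 0" using \<open>r > 0\<close> by (simp add: d_def)
    have "\<forall>\<^sub>F n in sequentially. 1 \<le> d * (real n * q $ l)" for l
    proof -
      have "\<forall>\<^sub>F n in sequentially. 1 / (d * q $ l) \<le> real n"
        using filterlim_real_sequentially by (simp add: filterlim_at_top)
      then show ?thesis
        by eventually_elim (use \<open>d > 0\<close> q(1)[of l] in \<open>simp add: field_simps\<close>)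
    qed
    \<comment> \<open>There are finitely many coordinates, so one threshold for \<open>n\<close>
      serves them all.\<close>
    then have "\<forall>\<^sub>F n in sequentially. \<forall>l. 1 \<le> d * (real n * q $ l)"
      by (rule eventually_all_finite)
    moreover have "\<forall>\<^sub>F n in sequentially. n \<ge> CARD('m)" by (rule eventually_ge_at_top)
    ultimately have "\<forall>\<^sub>F n in sequentially. norm ((real_vec (N n) /\<^sub>R real n) $ i - q $ i) < r"
    proof eventually_elim
      case (elim n)
      let ?x = "real_vec (N n) /\<^sub>R real n"
      have "n > 0" using elim(2) by (metis zero_less_card_finite less_le_trans)
      then have Nn: "is_arg_max (joint_weight q n) (\<lambda>k. k \<in> occurrence_vectors n) (N n)"
        using assms(3) by simp
      have x: "?x $ l = real (N n $ l) / real n" for l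
        by (simp add: real_vec_def divide_inverse_commute)
      have "(\<Sum>l\<in>UNIV. ?x $ l) = real (\<Sum>l\<in>UNIV. N n $ l) / real n"
        unfolding x by (simp add: sum_divide_distrib)
      also have "\<dots> = 1"
        using Nn \<open>n > 0\<close> by (simp add: is_arg_max_def occurrence_vectors_def del: of_nat_sum)
      finally have "(\<Sum>l\<in>UNIV. ?x $ l) = 1" .
      moreover have "?x $ l \<le> (1 + 2 * d) * q $ l" for l
        unfolding x using arg_max_coord_upper_bound[OF q Nn elim(2) \<open>d > 0\<close>, of l] elim(1) \<open>n > 0\<close>
        by (simp add: pos_divide_le_eq mult_ac)
      ultimately have "\<bar>?x $ i - q $ i\<bar> \<le> 2 * d"
        using \<open>d > 0\<close> by (intro prob_vector_close[OF q]) auto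
      then show ?case using \<open>r > 0\<close> by (simp add: d_def)
    qed
    then show "\<exists>n0. \<forall>n\<ge>n0. norm ((real_vec (N n) /\<^sub>R real n) $ i - q $ i) < r"
      by (simp add: eventually_sequentially)
  qed
  then have "(\<lambda>n. real_vec (N n) /\<^sub>R real n) \<longlonglongrightarrow> q" by (rule vec_tendstoI)
  then show ?thesis using jeffreys_entropy_arg_max[OF q assms(4)] by simp
qed

end
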